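(* Let $\mathcal C\subset\mathbb R^n$ be a homogeneous cone, and let $F$ be a $\vartheta$-logarithmically homogeneous self-concordant barrier for $\mathcal C$ with the following properties: (a) $\vartheta\le n$; (b) there is a real-valued function $g$ on $\operatorname{Aut}(\mathcal C)$ such that $F(L(x))=F(x)+g(L)$ for every $L\in\operatorname{Aut}(\mathcal C)$ and $x\in\operatorname{int}(\mathcal C)$; (c) for every $u\in\mathcal C$ the function $f_u:\operatorname{int}(\mathcal C)\to\mathbb R$, $f_u(x)=\langle-\nabla F(x),u\rangle$, is convex; (d) for every $x\in\operatorname{int}(\mathcal C)$ there exists $L\in\operatorname{Aut}(\mathcal C)$ such that $\nabla^2F(x)=L^\star L$. Let $\mathcal A\subseteq\mathcal C$ and $\mathcal B\subseteq\mathcal C^\star$ be finite sets and let $\Delta$ be a real number such that $\langle a,b\rangle\le\Delta$ for all $a\in\mathcal A$, $b\in\mathcal B$. Assume further that $\operatorname{cone}(\mathcal A)$ intersects the interior of $\mathcal C$ and $\operatorname{cone}(\mathcal B)$ intersects the interior of $\mathcal C^\star$. Then there exists an automorphism $x\mapsto Lx$ of $\mathcal C$ such that $$\langle La,La\rangle\le\vartheta\Delta\quad\text{and}\quad\langle L^{-\star}b,L^{-\star}b\rangle\le\vartheta\Delta\qquad\text{for all }a\in\mathcal A,\ b\in\mathcal B,$$ where $L^{-\star}$ is the inverse of the adjoint of $L$.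
   Context: $\mathbb R^n$ carries an inner product $\langle\cdot,\cdot\rangle$ (the standard one); duals, adjoints $L^\star$, gradients and Hessians are taken with respect to it. A convex cone is regular if it is closed, pointed and has nonempty interior. The dual cone is $\mathcal C^\star=\{x\in\mathbb R^n:\langle x,y\rangle\ge0\text{ for all }y\in\mathcal C\}$. $\operatorname{Aut}(\mathcal C)$ is the group of invertible linear maps $L$ on $\mathbb R^n$ with $L(\mathcal C)=\mathcal C$. A regular convex cone $\mathcal C$ is homogeneous if $\operatorname{Aut}(\mathcal C)$ acts transitively on $\operatorname{int}(\mathcal C)$. $\operatorname{cone}(S)$ is the set of all finite nonnegative linear combinations of elements of $S$. For $\vartheta\ge1$, a $\vartheta$-logarithmically homogeneous self-concordant barrier for $\mathcal C$ is a three times continuously differentiable convex function $F:\operatorname{int}(\mathcal C)\to\mathbb R$ such that: $F(x^{(k)})\to+\infty$ for every sequence in $\operatorname{int}(\mathcal C)$ converging to a boundary point of $\mathcal C$; $|D^3F(x)[h,h,h]|\le 2\,(D^2F(x)[h,h])^{3/2}$ for all $x\in\operatorname{int}(\mathcal C)$, $h\in\mathbb R^n$; and $F(tx)=F(x)-\vartheta\ln t$ for all $x\in\operatorname{int}(\mathcal C)$, $t>0$. (It is known that every homogeneous cone admits such an $F$ with properties (a)–(d).) *)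

theory Defs
  imports "HOL-Analysis.Analysis"
begin

definition regular_cone :: "'a::euclidean_space set \<Rightarrow> bool" where
  "regular_cone C \<longleftrightarrow>
     convex_cone C \<and> closed C \<and> (\<forall>x. x \<in> C \<and> - x \<in> C \<longrightarrow> x = 0) \<and> interior C \<noteq> {}"

definition dual_cone :: "'a::euclidean_space set \<Rightarrow> 'a set" where
  "dual_cone C = {x. \<forall>y\<in>C. x \<bullet> y \<ge> 0}"

definition cone_aut :: "'a::euclidean_space set \<Rightarrow> ('a \<Rightarrow> 'a) set" where
  "cone_aut C = {L. linear L \<and> bij L \<and> L ` C = C}"

definition homogeneous_cone :: "'a::euclidean_space set \<Rightarrow> bool" where
  "homogeneous_cone C \<longleftrightarrow>
     regular_cone C \<and> (\<forall>x\<in>interior C. \<forall>y\<in>interior C. \<exists>L\<in>cone_aut C. L x = y)"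

definition cone_span :: "'a::real_vector set \<Rightarrow> 'a set" where
  "cone_span S = {(\<Sum>v\<in>T. c v *\<^sub>R v) |T c. finite T \<and> T \<subseteq> S \<and> (\<forall>v\<in>T. 0 \<le> c v)}"

text \<open>
  The Frechet derivative at a point, packaged as a bounded linear map, so that it can be iterated:
  \<open>blinfun_deriv (blinfun_deriv (blinfun_deriv f)) x h k l\<close> is the third derivative of \<open>f\<close> at \<open>x\<close>
  in the directions \<open>h\<close>, \<open>k\<close>, \<open>l\<close>. The value is unspecified where \<open>f\<close> is not differentiable.
\<close>

definition blinfun_deriv ::
    "('a::euclidean_space \<Rightarrow> 'b::real_normed_vector) \<Rightarrow> 'a \<Rightarrow> 'a \<Rightarrow>\<^sub>L 'b" where
  "blinfun_deriv f x = Blinfun (frechet_derivative f (at x))"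

lemma has_derivative_blinfun_deriv:
  assumes "f differentiable (at x)"
  shows "(f has_derivative blinfun_apply (blinfun_deriv f x)) (at x)"
  using assms has_derivative_bounded_linear bounded_linear_Blinfun_apply
  unfolding blinfun_deriv_def by (metis frechet_derivative_works)

text \<open>Meant for open \<open>S\<close>: values of \<open>f\<close> outside \<open>S\<close> are then irrelevant.\<close>

definition C3_on :: "'a::euclidean_space set \<Rightarrow> ('a \<Rightarrow> real) \<Rightarrow> bool" where
  "C3_on S f \<longleftrightarrow>
     (\<forall>x\<in>S. f differentiable (at x)) \<and>
     (\<forall>x\<in>S. blinfun_deriv f differentiable (at x)) \<and>
     (\<forall>x\<in>S. blinfun_deriv (blinfun_deriv f) differentiable (at x)) \<and>
     continuous_on S (blinfun_deriv (blinfun_deriv (blinfun_deriv f)))"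

definition grad :: "('a::euclidean_space \<Rightarrow> real) \<Rightarrow> 'a \<Rightarrow> 'a" where
  "grad f x = (THE g. GDERIV f x :> g)"

lemma gderiv_grad:
  assumes "f differentiable (at x)"
  shows "GDERIV f x :> grad f x"
proof -
  let ?D = "frechet_derivative f (at x)"
  have D: "(f has_derivative ?D) (at x)"
    using assms by (simp add: frechet_derivative_works)
  then have "linear ?D"
    by (rule has_derivative_linear)
  then have "?D = (\<lambda>h. h \<bullet> adjoint ?D 1)"
    by (auto simp: adjoint_works inner_commute)
  then have ex: "GDERIV f x :> adjoint ?D 1"
    using D by (simp add: gderiv_def)
  have "g = adjoint ?D 1" if "GDERIV f x :> g" for g
  proof -
    have "(\<lambda>h. h \<bullet> g) = (\<lambda>h. h \<bullet> adjoint ?D 1)"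
      using that ex unfolding gderiv_def by (rule has_derivative_unique)
    then show ?thesis
      by (metis inner_commute vector_eq_rdot)
  qed
  with ex show ?thesis
    unfolding grad_def by (rule theI)
qed

text \<open>
  The Hessian as a linear operator on the space, i.e. the derivative of the gradient field.
\<close>

definition hessian :: "('a::euclidean_space \<Rightarrow> real) \<Rightarrow> 'a \<Rightarrow> 'a \<Rightarrow> 'a" where
  "hessian f x = frechet_derivative (grad f) (at x)"

lemma hessian_inner:
  assumes "open S" "C3_on S f" "x \<in> S"
  shows "hessian f x h \<bullet> k = blinfun_deriv (blinfun_deriv f) x h k"
proof -
  let ?G = "\<lambda>y. \<Sum>b\<in>Basis. blinfun_deriv f y b *\<^sub>R b"
  let ?H = "\<lambda>h. \<Sum>b\<in>Basis. blinfun_deriv (blinfun_deriv f) x h b *\<^sub>R b"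
  have D1: "blinfun_deriv f y v = v \<bullet> grad f y" if "y \<in> S" for y v
  proof -
    have "f differentiable (at y)"
      using assms that by (auto simp: C3_on_def)
    then have "blinfun_apply (blinfun_deriv f y) = (\<lambda>h. h \<bullet> grad f y)"
      using has_derivative_unique[OF has_derivative_blinfun_deriv gderiv_grad[unfolded gderiv_def]]
      by blast
    then show ?thesis by simp
  qed
  have eq: "?G y = grad f y" if "y \<in> S" for y
    by (simp only: D1[OF that] inner_commute[of _ "grad f y"] euclidean_representation)
  have D2: "(blinfun_deriv f has_derivative blinfun_apply (blinfun_deriv (blinfun_deriv f) x)) (at x)"
    using assms by (intro has_derivative_blinfun_deriv) (auto simp: C3_on_def)
  have "(?G has_derivative ?H) (at x)"
  proof (rule has_derivative_sum)
    fix b :: 'a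
    have "bounded_linear (\<lambda>T. blinfun_apply T b *\<^sub>R b)" for b :: 'a
      by (intro bounded_linear_compose[OF bounded_linear_scaleR_left] blinfun.bounded_linear_left)
    then show "((\<lambda>y. blinfun_deriv f y b *\<^sub>R b) has_derivative
        (\<lambda>h. blinfun_deriv (blinfun_deriv f) x h b *\<^sub>R b)) (at x)"
      using D2 by (rule bounded_linear.has_derivative)
  qed
  then have "(grad f has_derivative ?H) (at x)"
    using has_derivative_transform_within_open[OF _ assms(1,3)] eq by blast
  then have "hessian f x = ?H"
    unfolding hessian_def by (rule frechet_derivative_at[symmetric])
  moreover have "?H h \<bullet> k = blinfun_deriv (blinfun_deriv f) x h k"
  proof -
    let ?l = "blinfun_apply (blinfun_deriv (blinfun_deriv f) x h)"
    have "linear ?l"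
      by (simp add: blinfun.bounded_linear_right bounded_linear.linear)
    then have "?l (\<Sum>b\<in>Basis. (k \<bullet> b) *\<^sub>R b) = (\<Sum>b\<in>Basis. (k \<bullet> b) * ?l b)"
      by (simp add: linear_sum linear_cmul)
    then have "?l k = (\<Sum>b\<in>Basis. (k \<bullet> b) * ?l b)"
      by (simp only: euclidean_representation)
    then show ?thesis
      by (simp add: inner_sum_left inner_commute[of k] mult.commute)
  qed
  ultimately show ?thesis by simp
qed

text \<open>
  The base of the \<open>powr\<close> below is nonnegative, since \<open>F\<close> is convex and three times continuously
  differentiable on the interior.
\<close>

definition lhscb :: "real \<Rightarrow> 'a::euclidean_space set \<Rightarrow> ('a \<Rightarrow> real) \<Rightarrow> bool" where
  "lhscb \<theta> C F \<longleftrightarrow>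
     \<theta> \<ge> 1 \<and>
     C3_on (interior C) F \<and>
     convex_on (interior C) F \<and>
     (\<forall>X z. (\<forall>k. X k \<in> interior C) \<and> X \<longlonglongrightarrow> z \<and> z \<in> frontier C
        \<longrightarrow> filterlim (\<lambda>k. F (X k)) at_top sequentially) \<and>
     (\<forall>x\<in>interior C. \<forall>h.
        \<bar>blinfun_deriv (blinfun_deriv (blinfun_deriv F)) x h h h\<bar>
          \<le> 2 * (blinfun_deriv (blinfun_deriv F) x h h) powr (3 / 2)) \<and>
     (\<forall>x\<in>interior C. \<forall>t>0. F (t *\<^sub>R x) = F x - \<theta> * ln t)"

end

theory Submission
  imports Defs
begin

text \<open>
  With \<open>H\<close> the Hessian of \<open>F\<close> at \<open>x\<close>, property (d) writes \<open>H = L\<^sup>\<star> L\<close> for an automorphism \<open>L\<close>, so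
  \<open>\<parallel>L a\<parallel>\<^sup>2 = \<langle>a, H a\<rangle>\<close> and \<open>\<parallel>L\<^sup>-\<^sup>\<star> b\<parallel>\<^sup>2 = \<langle>b, H\<^sup>-\<^sup>1 b\<rangle>\<close>. Self-concordance bounds these by
  \<open>\<langle>-\<nabla>F(x), a\<rangle>\<^sup>2\<close> (follow \<open>F\<close> along the ray \<open>x + t a\<close>) and by \<open>\<langle>b, x\<rangle>\<^sup>2\<close> (the Dikin ellipsoid lies
  in the cone). Hence it suffices to find \<open>x\<close> where \<open>\<alpha> = max\<^sub>a \<langle>-\<nabla>F(x), a\<rangle>\<close> and
  \<open>\<beta> = max\<^sub>b \<langle>b, x\<rangle>\<close> are both at most \<open>\<sigma>\<close> with \<open>\<sigma>\<^sup>2 \<le> \<theta> \<Delta>\<close>.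

  The product \<open>\<alpha> \<beta>\<close> is invariant under scaling of \<open>x\<close> and, because \<open>F\<close> blows up at the boundary,
  attains its minimum; scale the minimiser so that \<open>\<alpha> = \<beta> = \<sigma>\<close>. Stationarity gives \<open>H u = v\<close> for
  some convex combinations \<open>u\<close> and \<open>v\<close> of the active \<open>a\<close> and \<open>b\<close>. Since \<open>H x = -\<nabla>F(x)\<close> and
  \<open>\<langle>-\<nabla>F(x), x\<rangle> = \<theta>\<close>, Cauchy-Schwarz yields
  \<open>\<sigma>\<^sup>2 = \<langle>H x, u\<rangle>\<^sup>2 \<le> \<theta> \<langle>u, H u\<rangle> = \<theta> \<langle>u, v\<rangle> \<le> \<theta> \<Delta>\<close>.
\<close>

section \<open>Calculus along lines, finite maxima, spanned cones and adjoints\<close>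

lemma has_real_derivative_along_line:
  fixes f :: "'a::real_normed_vector \<Rightarrow> real"
  assumes "(f has_derivative f') (at (x + t *\<^sub>R h))"
  shows "((\<lambda>t. f (x + t *\<^sub>R h)) has_real_derivative f' h) (at t)"
proof -
  have "((\<lambda>t. x + t *\<^sub>R h) has_derivative (\<lambda>s. s *\<^sub>R h)) (at t)"
    by (auto intro!: derivative_eq_intros)
  then have "(f \<circ> (\<lambda>t. x + t *\<^sub>R h) has_derivative f' \<circ> (\<lambda>s. s *\<^sub>R h)) (at t)"
    using assms by (rule diff_chain_at)
  moreover have "f' (s *\<^sub>R h) = f' h * s" for s
    using has_derivative_linear[OF assms] by (simp add: linear_cmul)
  ultimately show ?thesis
    by (simp add: has_field_derivative_def o_def)
qed

lemma has_derivative_blinfun_apply: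
  assumes "(G has_derivative G') (at x)"
  shows "((\<lambda>y. blinfun_apply (G y) u) has_derivative (\<lambda>k. blinfun_apply (G' k) u)) (at x)"
  using assms by (rule bounded_linear.has_derivative[OF blinfun.bounded_linear_left])

lemma powr_neg_half: "x powr (-1/2) = 1 / sqrt x" if "0 \<le> x" for x :: real
  using that powr_minus_divide[of x "1/2"] by (simp add: powr_half_sqrt)

text \<open>The derivative of \<open>p powr (-1/2)\<close> is
  \<open>- p' / (2 * p powr (3/2))\<close>, which self-concordance bounds by 1 in absolute value;
  the mean value theorem does the rest.\<close>

lemma self_concordant_reciprocal_sqrt_lipschitz:
  fixes p p' :: "real \<Rightarrow> real"
  assumes "0 \<le> t"
    and der: "\<And>s. 0 \<le> s \<Longrightarrow> s \<le> t \<Longrightarrow> (p has_real_derivative p' s) (at s)"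
    and pos: "\<And>s. 0 \<le> s \<Longrightarrow> s \<le> t \<Longrightarrow> 0 < p s"
    and sc: "\<And>s. 0 \<le> s \<Longrightarrow> s \<le> t \<Longrightarrow> \<bar>p' s\<bar> \<le> 2 * p s powr (3 / 2)"
  shows "\<bar>1 / sqrt (p t) - 1 / sqrt (p 0)\<bar> \<le> t"
proof (cases "t = 0")
  case False
  have "((\<lambda>s. p s powr (-1/2)) has_real_derivative (- p' s / (2 * p s powr (3/2)))) (at s)"
    if "0 \<le> s" "s \<le> t" for s
  proof -
    have "((\<lambda>s. p s powr (-1/2)) has_real_derivative (-1/2 * p s powr (-1/2 - 1) * p' s)) (at s)"
      using der[OF that] pos[OF that] by (auto intro!: derivative_eq_intros)
    moreover have "p s powr (-1/2 - 1) = 1 / p s powr (3/2)"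
      by (simp add: powr_minus_divide[symmetric])
    ultimately show ?thesis
      by (simp add: field_simps)
  qed
  then have "\<exists>z. 0 < z \<and> z < t \<and>
      p t powr (-1/2) - p 0 powr (-1/2) = (t - 0) * (- p' z / (2 * p z powr (3/2)))"
    using False assms(1) by (intro MVT2[where f = "\<lambda>s. p s powr (-1/2)"]) auto
  then obtain z where z: "0 < z" "z < t"
    "p t powr (-1/2) - p 0 powr (-1/2) = t * (- p' z / (2 * p z powr (3/2)))"
    by auto
  have "\<bar>p' z / (2 * p z powr (3/2))\<bar> \<le> 1"
    using sc[of z] pos[of z] z by (simp add: field_simps abs_mult)
  then have "t * \<bar>p' z / (2 * p z powr (3/2))\<bar> \<le> t"
    by (rule mult_left_le[OF _ assms(1)])
  then have "\<bar>p t powr (-1/2) - p 0 powr (-1/2)\<bar> \<le> t"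
    using z(3) assms(1) by (simp add: abs_mult)
  then show ?thesis
    using powr_neg_half[of "p t"] powr_neg_half[of "p 0"] pos[of t] pos[of 0] assms(1)
    by (simp only: less_imp_le order_refl)
qed simp

lemma cone_aut_linear: "L \<in> cone_aut C \<Longrightarrow> linear L"
  and cone_aut_bij: "L \<in> cone_aut C \<Longrightarrow> bij L"
  by (auto simp: cone_aut_def)

lemma continuous_on_Max_image:
  fixes f :: "'i \<Rightarrow> 'a::topological_space \<Rightarrow> 'b::linorder_topology"
  assumes "finite I" "I \<noteq> {}" "\<And>i. i \<in> I \<Longrightarrow> continuous_on S (f i)"
  shows "continuous_on S (\<lambda>x. Max ((\<lambda>i. f i x) ` I))"
  using assms
proof (induction I rule: finite_ne_induct)
  case (insert i I)
  then have "continuous_on S (\<lambda>x. max (f i x) (Max ((\<lambda>i. f i x) ` I)))"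
    by (intro continuous_on_max) auto
  then show ?case using insert by simp
qed simp

lemma Max_image_mult_left:
  fixes f :: "'i \<Rightarrow> real"
  assumes "finite I" "I \<noteq> {}" "0 \<le> t"
  shows "Max ((\<lambda>i. t * f i) ` I) = t * Max (f ` I)"
proof -
  have "mono ((*) t)"
    using assms(3) by (auto simp: mono_def mult_left_mono)
  from mono_Max_commute[OF this, of "f ` I"] show ?thesis
    using assms by (simp add: image_image)
qed

text \<open>\<open>M\<close> is the sum of the coefficients of one representation of
  \<open>u\<close>. It is fixed before \<open>g\<close>, so a single constant serves the functionals
  attached to all points \<open>x\<close> of the cone.\<close>

lemma cone_span_linear_bound:
  assumes "u \<in> cone_span A"
  obtains M :: real where "0 \<le> M"
    "\<And>(g :: 'a::real_vector \<Rightarrow> real) m. linear g \<Longrightarrow> (\<And>a. a \<in> A \<Longrightarrow> g a \<le> m) \<Longrightarrow> g u \<le> M * m"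
proof -
  obtain T c where T: "finite T" "T \<subseteq> A" "\<And>v. v \<in> T \<Longrightarrow> 0 \<le> c v" "u = (\<Sum>v\<in>T. c v *\<^sub>R v)"
    using assms unfolding cone_span_def by auto
  show thesis
  proof
    show "0 \<le> sum c T" using T(3) by (rule sum_nonneg)
    fix g :: "'a \<Rightarrow> real" and m
    assume "linear g" and le: "\<And>a. a \<in> A \<Longrightarrow> g a \<le> m"
    then have "g u = (\<Sum>v\<in>T. c v * g v)"
      using T(4) by (simp add: linear_sum linear_cmul)
    also have "\<dots> \<le> (\<Sum>v\<in>T. c v * m)"
      using T le by (intro sum_mono mult_left_mono) auto
    finally show "g u \<le> sum c T * m" by (simp add: sum_distrib_right)
  qed
qed

text \<open>If the ball of radius \<open>e\<close> about \<open>v\<close> lies in the dual cone,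
  then so does \<open>v\<close> minus \<open>e\<close> times the unit vector along \<open>x\<close>;
  pairing it with \<open>x\<close> gives the estimate.\<close>

lemma interior_dual_cone_bound:
  assumes "v \<in> interior (dual_cone C)"
  obtains e where "0 < e" "\<And>x. x \<in> C \<Longrightarrow> e * norm x \<le> v \<bullet> x"
proof -
  obtain e where e: "0 < e" "cball v e \<subseteq> dual_cone C"
    using assms mem_interior_cball by blast
  have "e * norm x \<le> v \<bullet> x" if "x \<in> C" for x
  proof (cases "x = 0")
    case False
    then have "v - (e / norm x) *\<^sub>R x \<in> dual_cone C"
      using e by (intro subsetD[OF e(2)]) (simp add: dist_norm)
    then have "0 \<le> v \<bullet> x - e / norm x * (x \<bullet> x)"
      using that by (auto simp: dual_cone_def inner_diff_left)
    moreover have "e / norm x * (x \<bullet> x) = e * norm x"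
      using False by (simp add: power2_norm_eq_inner[symmetric] power2_eq_square)
    ultimately show ?thesis by simp
  qed simp
  with e(1) show thesis by (rule that)
qed

lemma bij_adjoint:
  fixes L :: "'a::euclidean_space \<Rightarrow> 'a"
  assumes "linear L" "bij L"
  shows "bij (adjoint L)"
proof -
  have "inj (adjoint L)"
  proof (rule linear_injective_0[THEN iffD2, OF adjoint_linear[OF assms(1)]], intro allI impI)
    fix w assume w: "adjoint L w = 0"
    obtain h where "L h = w" using assms(2) by (metis bij_pointE)
    then show "w = 0" using adjoint_works[OF assms(1), of h w] w by simp
  qed
  then show ?thesis
    using linear_injective_imp_surjective[OF adjoint_linear[OF assms(1)]] by (simp add: bij_def)
qed

definition max_pairing :: "'a::real_inner set \<Rightarrow> 'a \<Rightarrow> real" where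
  "max_pairing B x = Max ((\<lambda>b. b \<bullet> x) ` B)"

lemma max_pairing_ge: "finite B \<Longrightarrow> b \<in> B \<Longrightarrow> b \<bullet> x \<le> max_pairing B x"
  by (simp add: max_pairing_def)

lemma max_pairing_attained:
  assumes "finite B" "B \<noteq> {}"
  obtains b where "b \<in> B" "max_pairing B x = b \<bullet> x"
proof -
  have "max_pairing B x \<in> (\<lambda>b. b \<bullet> x) ` B"
    unfolding max_pairing_def using assms by (intro Max_in) auto
  then show thesis using that by blast
qed

lemma max_pairing_scaleR:
  "finite B \<Longrightarrow> B \<noteq> {} \<Longrightarrow> 0 < t \<Longrightarrow> max_pairing B (t *\<^sub>R x) = t * max_pairing B x"
  using Max_image_mult_left[of B t "\<lambda>b. b \<bullet> x"] by (simp add: max_pairing_def)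

text \<open>Each argument in turn is confined to a half-space, which is convex and so contains the
  hull.\<close>

lemma inner_le_on_convex_hulls:
  assumes "\<And>a b. a \<in> S \<Longrightarrow> b \<in> T \<Longrightarrow> a \<bullet> b \<le> \<Delta>"
    and "u \<in> convex hull S" "v \<in> convex hull T"
  shows "u \<bullet> v \<le> \<Delta>"
proof -
  have "convex hull T \<subseteq> {v. a \<bullet> v \<le> \<Delta>}" if "a \<in> S" for a
    using assms(1) that by (intro hull_minimal convex_halfspace_le) auto
  then have "convex hull S \<subseteq> {u. v \<bullet> u \<le> \<Delta>}"
    using assms(3) by (intro hull_minimal convex_halfspace_le) (auto simp: inner_commute)
  then show ?thesis using assms(2) by (auto simp: inner_commute)
qed

subsection \<open>Self-concordance on the cone\<close>

locale barrier_of_cone =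
  fixes C :: "'a::euclidean_space set" and F :: "'a \<Rightarrow> real" and \<theta> :: real
  assumes cone: "regular_cone C"
    and barrier: "lhscb \<theta> C F"
    and hessian_factor: "\<And>x. x \<in> interior C \<Longrightarrow> \<exists>L\<in>cone_aut C. hessian F x = adjoint L \<circ> L"
begin

abbreviation D1 :: "'a \<Rightarrow> 'a \<Rightarrow> real" where
  "D1 x h \<equiv> blinfun_deriv F x h"

abbreviation D2 :: "'a \<Rightarrow> 'a \<Rightarrow> 'a \<Rightarrow> real" where
  "D2 x h k \<equiv> blinfun_deriv (blinfun_deriv F) x h k"

abbreviation D3 :: "'a \<Rightarrow> 'a \<Rightarrow> 'a \<Rightarrow> 'a \<Rightarrow> real" where
  "D3 x h k l \<equiv> blinfun_deriv (blinfun_deriv (blinfun_deriv F)) x h k l"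

lemma theta_ge_1: "1 \<le> \<theta>"
  and C3: "C3_on (interior C) F"
  and blowup: "(\<And>k. X k \<in> interior C) \<Longrightarrow> X \<longlonglongrightarrow> z \<Longrightarrow> z \<in> frontier C \<Longrightarrow>
    filterlim (\<lambda>k. F (X k)) at_top sequentially"
  and self_concordant: "x \<in> interior C \<Longrightarrow> \<bar>D3 x h h h\<bar> \<le> 2 * D2 x h h powr (3 / 2)"
  and log_homogeneous: "x \<in> interior C \<Longrightarrow> 0 < t \<Longrightarrow> F (t *\<^sub>R x) = F x - \<theta> * ln t"
  using barrier unfolding lhscb_def by auto

lemma convex_cone_C: "convex_cone C" and interior_nonempty: "interior C \<noteq> {}"
  using cone unfolding regular_cone_def by auto

lemma convex_interior_C: "convex (interior C)"
  using convex_cone_C unfolding convex_cone_def by (blast intro: convex_interior)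

section \<open>Stability of the interior under scaling and under adding elements of the cone\<close>

lemma interior_scaleR:
  assumes "x \<in> interior C" "0 < t"
  shows "t *\<^sub>R x \<in> interior C"
proof -
  have "(*\<^sub>R) t ` interior C \<subseteq> interior C"
  proof (rule interior_maximal)
    show "(*\<^sub>R) t ` interior C \<subseteq> C"
      using convex_cone_scaleR[OF convex_cone_C, of t] interior_subset[of C] \<open>0 < t\<close> by auto
    show "open ((*\<^sub>R) t ` interior C)"
      using \<open>0 < t\<close> by (simp add: open_scaling)
  qed
  then show ?thesis using assms by blast
qed

lemma interior_add:
  assumes "x \<in> interior C" "a \<in> C"
  shows "x + a \<in> interior C"
proof -
  have "(+) a ` interior C \<subseteq> interior C"
  proof (rule interior_maximal)
    show "(+) a ` interior C \<subseteq> C"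
      using convex_cone_add[OF convex_cone_C \<open>a \<in> C\<close>] interior_subset[of C] by auto
    show "open ((+) a ` interior C)"
      by (simp add: open_translation)
  qed
  then have "a + x \<in> interior C" using assms(1) by blast
  then show ?thesis by (simp add: add.commute)
qed

section \<open>The Hessian as a positive definite form, and derivatives along lines\<close>

lemma hessian_form:
  fixes L :: "'a \<Rightarrow> 'a"
  assumes "x \<in> interior C" "hessian F x = adjoint L \<circ> L" "linear L"
  shows "D2 x h k = L h \<bullet> L k"
  using hessian_inner[OF open_interior C3 assms(1), of h k] assms(2)
    adjoint_works[OF assms(3), of k "L h"]
  by (simp add: inner_commute[of k] inner_commute[of "L k"])

lemma D2_nonneg:
  assumes "x \<in> interior C"
  shows "0 \<le> D2 x h h"
  using hessian_factor[OF assms] hessian_form[OF assms] cone_aut_linear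
  by (metis inner_ge_zero)

text \<open>Nondegeneracy comes from property (d): the form is the pullback of the inner product
  under an injective \<open>L\<close>.\<close>

lemma D2_pos:
  assumes "x \<in> interior C" "h \<noteq> 0"
  shows "0 < D2 x h h"
proof -
  obtain L where L: "L \<in> cone_aut C" "hessian F x = adjoint L \<circ> L"
    using hessian_factor assms by blast
  have "L h \<noteq> 0"
    using cone_aut_bij[OF L(1)] cone_aut_linear[OF L(1)] assms(2)
    by (metis bij_is_inj injD linear_0)
  then show ?thesis
    using hessian_form[OF assms(1) L(2) cone_aut_linear[OF L(1)]] by simp
qed

lemma has_derivative_F:
  assumes "x \<in> interior C" shows "(F has_derivative D1 x) (at x)"
  using C3 assms by (intro has_derivative_blinfun_deriv) (auto simp: C3_on_def)

lemma has_derivative_D1: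
  assumes "x \<in> interior C"
  shows "((\<lambda>y. D1 y u) has_derivative (\<lambda>k. D2 x k u)) (at x)"
  using C3 assms
  by (intro has_derivative_blinfun_apply has_derivative_blinfun_deriv) (auto simp: C3_on_def)

lemma has_derivative_D2:
  assumes "x \<in> interior C"
  shows "((\<lambda>y. D2 y u v) has_derivative (\<lambda>k. D3 x k u v)) (at x)"
  using C3 assms
  by (intro has_derivative_blinfun_apply has_derivative_blinfun_deriv) (auto simp: C3_on_def)

lemma continuous_on_D1: "continuous_on (interior C) (\<lambda>y. D1 y u)"
  using has_derivative_D1 has_derivative_continuous
  by (metis continuous_at_imp_continuous_on)

lemma F_along_line:
  assumes "x + t *\<^sub>R h \<in> interior C"
  shows "((\<lambda>t. F (x + t *\<^sub>R h)) has_real_derivative D1 (x + t *\<^sub>R h) h) (at t)"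
    and "((\<lambda>t. D1 (x + t *\<^sub>R h) u) has_real_derivative D2 (x + t *\<^sub>R h) h u) (at t)"
    and "((\<lambda>t. D2 (x + t *\<^sub>R h) u v) has_real_derivative D3 (x + t *\<^sub>R h) h u v) (at t)"
  using has_real_derivative_along_line[OF has_derivative_F[OF assms]]
    has_real_derivative_along_line[OF has_derivative_D1[OF assms]]
    has_real_derivative_along_line[OF has_derivative_D2[OF assms]] by auto

section \<open>Identities from logarithmic homogeneity\<close>

lemma D1_scaleR:
  assumes "x \<in> interior C" "0 < t"
  shows "D1 (t *\<^sub>R x) u = D1 x u / t"
proof -
  have "((\<lambda>y. t *\<^sub>R y) has_derivative (\<lambda>h. t *\<^sub>R h)) (at x)"
    by (auto intro!: derivative_eq_intros)
  then have "(F \<circ> (\<lambda>y. t *\<^sub>R y) has_derivative D1 (t *\<^sub>R x) \<circ> (\<lambda>h. t *\<^sub>R h)) (at x)"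
    using has_derivative_F[OF interior_scaleR[OF assms]] by (rule diff_chain_at)
  \<comment> \<open>For fixed \<open>t\<close> the term \<open>\<theta> * ln t\<close> is constant
    in \<open>y\<close>, so it disappears on differentiation.\<close>
  moreover have "(F \<circ> (\<lambda>y. t *\<^sub>R y) has_derivative D1 x) (at x)"
  proof (rule has_derivative_transform_within_open[of "\<lambda>y. F y - \<theta> * ln t"])
    show "((\<lambda>y. F y - \<theta> * ln t) has_derivative D1 x) (at x)"
      using has_derivative_F[OF assms(1)] by (auto intro!: derivative_eq_intros)
  qed (use assms log_homogeneous in auto)
  ultimately have "D1 (t *\<^sub>R x) \<circ> (\<lambda>h. t *\<^sub>R h) = D1 x"
    by (rule has_derivative_unique)
  then have "t * D1 (t *\<^sub>R x) u = D1 x u"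
    by (metis comp_apply blinfun.scaleR_right real_scaleR_def)
  then show ?thesis using \<open>0 < t\<close> by (simp add: field_simps)
qed

text \<open>Differentiate the homogeneity identity in \<open>t\<close> at \<open>t = 1\<close>; the
  ray is written as a line through 0 to fit \<open>F_along_line\<close>.\<close>

lemma D1_self:
  assumes "x \<in> interior C"
  shows "D1 x x = - \<theta>"
proof -
  have "((\<lambda>t. F (0 + t *\<^sub>R x)) has_real_derivative D1 (0 + 1 *\<^sub>R x) x) (at 1)"
    using assms by (intro F_along_line) simp
  moreover have "((\<lambda>t. F (0 + t *\<^sub>R x)) has_real_derivative - \<theta>) (at 1)"
  proof (rule has_field_derivative_transform_within_open[where S="{0<..}" and f="\<lambda>t. F x - \<theta> * ln t"])
    show "((\<lambda>t. F x - \<theta> * ln t) has_real_derivative - \<theta>) (at 1)"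
      by (auto intro!: derivative_eq_intros)
  qed (use assms log_homogeneous in auto)
  ultimately show ?thesis
    by (metis DERIV_unique add_0 scaleR_one)
qed

text \<open>The product rule applied to the constant function \<open>D1 y y = - \<theta>\<close>
  gives \<open>D1 x h + D2 x h x = 0\<close>.\<close>

lemma D2_self:
  assumes "x \<in> interior C"
  shows "D2 x h x = - D1 x h"
proof -
  have "((\<lambda>y. blinfun_apply (blinfun_deriv F y) y) has_derivative
      (\<lambda>h. blinfun_apply (blinfun_deriv F x) h + blinfun_apply (blinfun_deriv (blinfun_deriv F) x h) x)) (at x)"
    using C3 assms
    by (intro bounded_bilinear.FDERIV[OF bounded_bilinear_blinfun_apply] has_derivative_blinfun_deriv)
      (auto simp: C3_on_def intro!: derivative_eq_intros)
  moreover have "((\<lambda>y. blinfun_apply (blinfun_deriv F y) y) has_derivative (\<lambda>h. 0)) (at x)"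
    by (rule has_derivative_transform_within_open[of "\<lambda>y. - \<theta>" _ _ _ "interior C"])
      (use assms D1_self in auto)
  ultimately have "(\<lambda>h. D1 x h + D2 x h x) = (\<lambda>h. 0)"
    by (rule has_derivative_unique)
  then show ?thesis
    by (metis add.commute add_eq_0_iff)
qed

text \<open>Cauchy-Schwarz for the form \<open>D2 x\<close> on \<open>h\<close> and
  \<open>x\<close>, where \<open>D2 x h x = - D1 x h\<close> and
  \<open>D2 x x x = \<theta>\<close>.\<close>

lemma D1_squared_le:
  assumes "x \<in> interior C"
  shows "(D1 x h)\<^sup>2 \<le> \<theta> * D2 x h h"
proof -
  obtain L where L: "L \<in> cone_aut C" "hessian F x = adjoint L \<circ> L"
    using hessian_factor assms by blast
  note H = hessian_form[OF assms L(2) cone_aut_linear[OF L(1)]]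
  have "(L h \<bullet> L x)\<^sup>2 \<le> (L h \<bullet> L h) * (L x \<bullet> L x)"
    by (rule Cauchy_Schwarz_ineq)
  then show ?thesis
    using D2_self[OF assms, of h] D2_self[OF assms, of x] D1_self[OF assms]
    by (simp add: H[symmetric] mult.commute)
qed

section \<open>Convexity of the barrier and the sign of its slopes\<close>

lemma interior_segment:
  assumes "x \<in> interior C" "y \<in> interior C" "0 \<le> t" "t \<le> 1"
  shows "x + t *\<^sub>R (y - x) \<in> interior C"
proof -
  have "(1 - t) *\<^sub>R x + t *\<^sub>R y \<in> interior C"
    using convex_interior_C assms by (intro convexD) auto
  then show ?thesis by (simp add: algebra_simps)
qed

lemma F_above_tangent:
  assumes "x \<in> interior C" "y \<in> interior C"
  shows "F x + D1 x (y - x) \<le> F y"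
proof -
  let ?h = "y - x"
  obtain s where s: "0 < s" "s < 1"
    "F (x + 1 *\<^sub>R ?h) - F (x + 0 *\<^sub>R ?h) = (1 - 0) * D1 (x + s *\<^sub>R ?h) ?h"
    using MVT2[of 0 1 "\<lambda>t. F (x + t *\<^sub>R ?h)" "\<lambda>t. D1 (x + t *\<^sub>R ?h) ?h"]
      F_along_line(1) interior_segment[OF assms] by auto
  have "D1 (x + 0 *\<^sub>R ?h) ?h \<le> D1 (x + s *\<^sub>R ?h) ?h"
  proof (rule DERIV_nonneg_imp_nondecreasing[where f = "\<lambda>t. D1 (x + t *\<^sub>R ?h) ?h"])
    fix t assume t: "0 \<le> t" "t \<le> s"
    then have "x + t *\<^sub>R ?h \<in> interior C"
      using s by (intro interior_segment assms) auto
    then show "\<exists>l. ((\<lambda>t. D1 (x + t *\<^sub>R ?h) ?h) has_real_derivative l) (at t) \<and> 0 \<le> l"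
      using F_along_line(2) D2_nonneg by blast
  qed (use s in simp)
  then show ?thesis using s by simp
qed

text \<open>Along the ray through \<open>u\<close> the barrier tends to minus infinity like
  \<open>- \<theta> * ln t\<close>, whereas with a nonnegative slope the tangent at \<open>x\<close>
  would bound it from below.\<close>

lemma D1_neg:
  assumes x: "x \<in> interior C" and u: "u \<in> interior C"
  shows "D1 x u < 0"
proof (rule ccontr)
  assume "\<not> D1 x u < 0"
  \<comment> \<open>At scale \<open>exp K\<close> the logarithm is \<open>K\<close>; this
    \<open>K\<close> exceeds \<open>F u - F x - \<theta>\<close>, the most that the tangent
    inequality would allow.\<close>
  define K where "K = \<bar>F u - F x - \<theta>\<bar> + 1"
  have "F x + D1 x (exp K *\<^sub>R u - x) \<le> F (exp K *\<^sub>R u)"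
    using x interior_scaleR[OF u] by (intro F_above_tangent) auto
  also have "\<dots> = F u - \<theta> * K"
    using log_homogeneous[OF u, of "exp K"] by simp
  finally have "F x + exp K * D1 x u + \<theta> \<le> F u - \<theta> * K"
    using D1_self[OF x] by (simp add: blinfun.diff_right blinfun.scaleR_right)
  moreover have "1 * K \<le> \<theta> * K"
    using theta_ge_1 by (intro mult_right_mono) (auto simp: K_def)
  moreover have "0 \<le> exp K * D1 x u"
    using \<open>\<not> D1 x u < 0\<close> by simp
  ultimately show False
    by (simp add: K_def)
qed

lemma D1_nonpos:
  assumes x: "x \<in> interior C" and u: "u \<in> C"
  shows "D1 x u \<le> 0"
proof (rule ccontr)
  assume neg: "\<not> D1 x u \<le> 0"
  \<comment> \<open>Chosen so that
    \<open>D1 x (x + t *\<^sub>R u) = - \<theta> + (\<theta> + 1) = 1\<close>, which is impossible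
    at an interior point.\<close>
  define t where "t = (\<theta> + 1) / D1 x u"
  have "0 \<le> t" using neg theta_ge_1 by (simp add: t_def)
  then have "x + t *\<^sub>R u \<in> interior C"
    using convex_cone_scaleR[OF convex_cone_C _ u] by (intro interior_add x)
  from D1_neg[OF x this] show False
    using neg D1_self[OF x] by (simp add: blinfun.add_right blinfun.scaleR_right t_def)
qed

section \<open>Self-concordance estimates along rays and inside the Dikin ellipsoid\<close>

lemma reciprocal_sqrt_D2_lipschitz:
  assumes "0 \<le> t" "h \<noteq> 0"
    and line: "\<And>s. 0 \<le> s \<Longrightarrow> s \<le> t \<Longrightarrow> x + s *\<^sub>R h \<in> interior C"
  shows "\<bar>1 / sqrt (D2 (x + t *\<^sub>R h) h h) - 1 / sqrt (D2 x h h)\<bar> \<le> t"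
proof -
  have "\<bar>1 / sqrt (D2 (x + t *\<^sub>R h) h h) - 1 / sqrt (D2 (x + 0 *\<^sub>R h) h h)\<bar> \<le> t"
    using assms(1)
    by (rule self_concordant_reciprocal_sqrt_lipschitz[where p = "\<lambda>t. D2 (x + t *\<^sub>R h) h h"
          and p' = "\<lambda>t. D3 (x + t *\<^sub>R h) h h h"])
      (intro F_along_line(3) self_concordant D2_pos line assms(2); assumption)+
  then show ?thesis by simp
qed

text \<open>The Lipschitz estimate gives \<open>p t \<ge> 1 / (q + t)\<^sup>2\<close>, so the slope
  plus \<open>1 / (q + t)\<close> is nondecreasing along the ray. The slope never becomes positive,
  so letting \<open>t\<close> grow gives \<open>D1 x u + 1 / q \<le> 0\<close>, where
  \<open>1 / q\<close> is the square root of \<open>D2 x u u\<close>.\<close>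

lemma ray_bound:
  assumes x: "x \<in> interior C" and u: "u \<in> C"
  shows "D2 x u u \<le> (D1 x u)\<^sup>2"
proof (cases "u = 0")
  case False
  have ray: "x + t *\<^sub>R u \<in> interior C" if "0 \<le> t" for t
    using convex_cone_scaleR[OF convex_cone_C that u] by (intro interior_add x)
  define p where "p t = D2 (x + t *\<^sub>R u) u u" for t
  define q where "q = 1 / sqrt (p 0)"
  have p_pos: "0 < p t" if "0 \<le> t" for t
    using D2_pos[OF ray[OF that] False] by (simp add: p_def)
  have q_pos: "0 < q" using p_pos[of 0] by (simp add: q_def)
  have p_ge: "1 / (q + t)\<^sup>2 \<le> p t" if "0 \<le> t" for t
  proof -
    have "\<bar>1 / sqrt (p t) - 1 / sqrt (p 0)\<bar> \<le> t"
      using reciprocal_sqrt_D2_lipschitz[OF that False ray] by (simp add: p_def)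
    then have "1 / sqrt (p t) \<le> q + t" by (simp add: q_def)
    then have "1 / (q + t) \<le> sqrt (p t)"
      using p_pos[OF that] q_pos that by (simp add: field_simps add_pos_nonneg)
    then have "(1 / (q + t))\<^sup>2 \<le> (sqrt (p t))\<^sup>2"
      using q_pos that by (intro power_mono) auto
    then show ?thesis using p_pos[OF that] by (simp add: power_divide)
  qed
  have mono: "D1 (x + 0 *\<^sub>R u) u + 1 / (q + 0) \<le> D1 (x + t *\<^sub>R u) u + 1 / (q + t)" if "0 \<le> t" for t
  proof (rule DERIV_nonneg_imp_nondecreasing[where f = "\<lambda>t. D1 (x + t *\<^sub>R u) u + 1 / (q + t)", OF that])
    fix s assume s: "0 \<le> s" "s \<le> t"
    have "((\<lambda>t. D1 (x + t *\<^sub>R u) u + 1 / (q + t)) has_real_derivative p s - 1 / (q + s)\<^sup>2) (at s)"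
      using F_along_line(2)[OF ray[OF s(1)], of u] q_pos s(1)
      by (auto intro!: derivative_eq_intros simp: p_def power2_eq_square)
    then show "\<exists>l. ((\<lambda>t. D1 (x + t *\<^sub>R u) u + 1 / (q + t)) has_real_derivative l) (at s) \<and> 0 \<le> l"
      using p_ge[OF s(1)] by (intro exI conjI) auto
  qed
  have bound: "D1 x u + 1 / q \<le> 1 / (q + t)" if "0 \<le> t" for t
    using mono[OF that] D1_nonpos[OF ray[OF that] u] by simp
  have "D1 x u + 1 / q \<le> 0"
  proof (rule field_le_epsilon)
    fix e :: real assume "0 < e"
    have "1 / (q + 1 / e) \<le> e"
      using frac_le[of 1 1 "1 / e" "q + 1 / e"] q_pos \<open>0 < e\<close> by simp
    then show "D1 x u + 1 / q \<le> 0 + e"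
      using bound[of "1 / e"] \<open>0 < e\<close> by simp
  qed
  then have "(1 / q)\<^sup>2 \<le> (- D1 x u)\<^sup>2"
    using q_pos by (intro power_mono) auto
  then show ?thesis
    using p_pos[of 0] by (simp add: q_def p_def)
qed simp

text \<open>
  If the segment left the cone at \<open>t = T \<le> 1\<close>, the Lipschitz bound would keep \<open>D2\<close> and hence \<open>F\<close>
  bounded up to \<open>T\<close>, contradicting the blow-up at the frontier.
\<close>

lemma dikin_ellipsoid:
  assumes x: "x \<in> interior C" and h: "D2 x h h < 1"
  shows "x + h \<in> interior C"
proof (rule ccontr)
  assume out: "x + h \<notin> interior C"
  then have "h \<noteq> 0" using x by auto
  \<comment> \<open>The parameters at which the segment is outside the interior. As \<open>E\<close>
    is closed, its infimum is attained and is the first exit time \<open>T\<close>.\<close>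
  define E where "E = {0..1} \<inter> (\<lambda>t. x + t *\<^sub>R h) -` (- interior C)"
  have "closed E"
    unfolding E_def by (intro closed_Int closed_vimage continuous_intros) auto
  moreover have "bdd_below E" by (auto simp: E_def bdd_below_def)
  moreover have "1 \<in> E" using out by (simp add: E_def)
  ultimately have TE: "Inf E \<in> E" by (intro closed_contains_Inf) auto
  define T where "T = Inf E"
  have T: "0 \<le> T" "T \<le> 1" "x + T *\<^sub>R h \<notin> interior C" using TE by (auto simp: T_def E_def)
  have "T \<noteq> 0" using T x by auto
  then have T0: "0 < T" using T by simp
  have inside: "x + t *\<^sub>R h \<in> interior C" if "0 \<le> t" "t < T" for t
  proof (rule ccontr)
    assume "x + t *\<^sub>R h \<notin> interior C"
    then have "t \<in> E" using that T by (simp add: E_def)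
    then have "T \<le> t" unfolding T_def using \<open>bdd_below E\<close> by (rule cInf_lower)
    then show False using that by simp
  qed
  define p where "p t = D2 (x + t *\<^sub>R h) h h" for t
  \<comment> \<open>Positive because \<open>p 0 < 1\<close>. Since \<open>t \<le> 1\<close>, the
    Lipschitz estimate keeps \<open>1 / sqrt (p t)\<close> above \<open>c\<close>.\<close>
  define c where "c = 1 / sqrt (p 0) - 1"
  have p_pos: "0 < p t" if "0 \<le> t" "t < T" for t
    using D2_pos[OF inside[OF that] \<open>h \<noteq> 0\<close>] by (simp add: p_def)
  have "0 < c"
    using p_pos[of 0] T0 h by (simp add: c_def p_def)
  have p_le: "p t \<le> (1 / c)\<^sup>2" if "0 \<le> t" "t < T" for t
  proof -
    have "\<bar>1 / sqrt (p t) - 1 / sqrt (p 0)\<bar> \<le> t"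
      using reciprocal_sqrt_D2_lipschitz[OF that(1) \<open>h \<noteq> 0\<close> inside] that(2) by (simp add: p_def)
    then have "c \<le> 1 / sqrt (p t)" using that T by (simp add: c_def)
    then have "sqrt (p t) \<le> 1 / c"
      using \<open>0 < c\<close> p_pos[OF that] by (simp add: field_simps)
    then have "(sqrt (p t))\<^sup>2 \<le> (1 / c)\<^sup>2"
      using p_pos[OF that] by (intro power_mono) auto
    then show ?thesis
      using p_pos[OF that] by simp
  qed
  \<comment> \<open>The initial slope plus the bound on \<open>p\<close> over a length of at most 1.
    The absolute value makes \<open>M1\<close> nonnegative, so that \<open>t * M1 \<le> M1\<close>
    in the bound on \<open>F\<close>.\<close>
  define M1 where "M1 = \<bar>D1 x h\<bar> + (1 / c)\<^sup>2"
  have D1_le: "D1 (x + t *\<^sub>R h) h \<le> M1" if t: "0 \<le> t" "t < T" for t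
  proof (cases "t = 0")
    case False
    have "\<exists>s. 0 < s \<and> s < t \<and> D1 (x + t *\<^sub>R h) h - D1 (x + 0 *\<^sub>R h) h = (t - 0) * p s"
    proof (rule MVT2[where f = "\<lambda>t. D1 (x + t *\<^sub>R h) h"])
      fix s assume "0 \<le> s" "s \<le> t"
      then show "((\<lambda>t. D1 (x + t *\<^sub>R h) h) has_real_derivative p s) (at s)"
        unfolding p_def using t by (intro F_along_line inside) auto
    qed (use t False in simp)
    then obtain s where s: "0 < s" "s < t"
      "D1 (x + t *\<^sub>R h) h - D1 (x + 0 *\<^sub>R h) h = (t - 0) * p s" by blast
    have "t * p s \<le> 1 * (1 / c)\<^sup>2"
      using t s T p_le[of s] p_pos[of s] by (intro mult_mono) auto
    then show ?thesis using s by (simp add: M1_def)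
  next
    case True
    have "0 \<le> (1 / c)\<^sup>2" by simp
    then have "D1 x h \<le> M1" using abs_ge_self[of "D1 x h"] unfolding M1_def by linarith
    then show ?thesis using True by simp
  qed
  have "0 \<le> M1" unfolding M1_def by (intro add_nonneg_nonneg) auto
  have F_le: "F (x + t *\<^sub>R h) \<le> F x + M1" if t: "0 \<le> t" "t < T" for t
  proof (cases "t = 0")
    case False
    have "\<exists>s. 0 < s \<and> s < t \<and>
        F (x + t *\<^sub>R h) - F (x + 0 *\<^sub>R h) = (t - 0) * D1 (x + s *\<^sub>R h) h"
    proof (rule MVT2[where f = "\<lambda>t. F (x + t *\<^sub>R h)"])
      fix s assume "0 \<le> s" "s \<le> t"
      then show "((\<lambda>t. F (x + t *\<^sub>R h)) has_real_derivative D1 (x + s *\<^sub>R h) h) (at s)"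
        using t by (intro F_along_line inside) auto
    qed (use t False in simp)
    then obtain s where s: "0 < s" "s < t"
      "F (x + t *\<^sub>R h) - F (x + 0 *\<^sub>R h) = (t - 0) * D1 (x + s *\<^sub>R h) h" by blast
    have "t * D1 (x + s *\<^sub>R h) h \<le> t * M1"
      using t s D1_le[of s] by (intro mult_left_mono) auto
    also have "\<dots> \<le> 1 * M1"
      using t T \<open>0 \<le> M1\<close> by (intro mult_right_mono) auto
    finally show ?thesis using s by simp
  qed (use \<open>0 \<le> M1\<close> in simp)
  \<comment> \<open>Parameters in \<open>[0, T)\<close> tending to \<open>T\<close>;
    \<open>Suc\<close> makes the sequence start at 0.\<close>
  define r where "r k = T * (1 - 1 / real (Suc k))" for k
  define X where "X k = x + r k *\<^sub>R h" for k
  have r: "0 \<le> r k" "r k < T" for k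
    using T0 by (auto simp: r_def field_simps)
  have X_in: "X k \<in> interior C" for k
    unfolding X_def using r by (rule inside)
  have "r \<longlonglongrightarrow> T * (1 - 0)"
    unfolding r_def by (intro tendsto_intros LIMSEQ_Suc lim_1_over_n)
  then have lim: "X \<longlonglongrightarrow> x + T *\<^sub>R h"
    unfolding X_def by (auto intro!: tendsto_intros)
  have "x + T *\<^sub>R h \<in> closure C"
    using lim X_in interior_subset closure_sequential by blast
  then have "x + T *\<^sub>R h \<in> frontier C"
    using T by (simp add: frontier_def)
  then have "filterlim (\<lambda>k. F (X k)) at_top sequentially"
    using blowup X_in lim by blast
  then have "\<forall>\<^sub>F k in sequentially. F x + M1 + 1 \<le> F (X k)"
    by (simp only: filterlim_at_top)
  then obtain k where "F x + M1 + 1 \<le> F (X k)"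
    using eventually_happens'[OF sequentially_bot] by blast
  then show False
    using F_le[OF r, of k] by (simp add: X_def)
qed

text \<open>With \<open>w = inv (adjoint L) b\<close> and \<open>L v = w\<close>, the pairing of
  \<open>b\<close> with \<open>v\<close> is the squared norm of \<open>w\<close>. Moving from
  \<open>x\<close> against \<open>v\<close> by Hessian length \<open>t < 1\<close> stays in the cone
  by the Dikin ellipsoid, so \<open>t * norm w \<le> b \<bullet> x\<close>; then \<open>t\<close>
  tends to 1.\<close>

lemma dual_bound:
  assumes x: "x \<in> interior C" and b: "b \<in> dual_cone C"
    and L: "L \<in> cone_aut C" "hessian F x = adjoint L \<circ> L"
  shows "inv (adjoint L) b \<bullet> inv (adjoint L) b \<le> (b \<bullet> x)\<^sup>2"
proof -
  note lin = cone_aut_linear[OF L(1)] and bij = cone_aut_bij[OF L(1)]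
  define w where "w = inv (adjoint L) b"
  have w: "adjoint L w = b"
    unfolding w_def using bij_adjoint[OF lin bij] by (simp add: bij_is_surj surj_f_inv_f)
  obtain v where v: "L v = w" using bij by (metis bij_pointE)
  have bv: "b \<bullet> v = (norm w)\<^sup>2"
    using adjoint_works[OF lin, of v w] by (simp add: w v inner_commute power2_norm_eq_inner)
  have "norm w \<le> b \<bullet> x" if "w \<noteq> 0"
  proof (rule field_le_mult_one_interval)
    fix t :: real assume t: "0 < t" "t < 1"
    \<comment> \<open>The displacement of Hessian length \<open>t\<close> on which \<open>b\<close>
      is smallest.\<close>
    define h where "h = (- (t / norm w)) *\<^sub>R v"
    have "L h = (- (t / norm w)) *\<^sub>R w"
      unfolding h_def linear_cmul[OF lin] v ..
    then have "D2 x h h = (t / norm w)\<^sup>2 * (w \<bullet> w)"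
      using hessian_form[OF x L(2) lin, of h h]
      by (simp add: power2_eq_square)
    also have "\<dots> = t\<^sup>2"
      using that by (simp add: power2_norm_eq_inner[symmetric] power_divide)
    also have "\<dots> < 1"
      using t by (simp add: power2_less_1_iff abs_less_iff)
    finally have "x + h \<in> C"
      using dikin_ellipsoid[OF x] interior_subset by blast
    then have "0 \<le> b \<bullet> (x + h)" using b by (simp add: dual_cone_def)
    also have "b \<bullet> (x + h) = b \<bullet> x - t * norm w"
      using that unfolding h_def inner_add_right inner_scaleR_right bv
      by (simp add: power2_eq_square)
    finally show "t * norm w \<le> b \<bullet> x" by simp
  qed
  then have "(norm w)\<^sup>2 \<le> (b \<bullet> x)\<^sup>2"
    by (cases "w = 0") (auto intro: power_mono)
  then show ?thesis
    by (simp add: w_def power2_norm_eq_inner)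
qed

subsection \<open>Minimising the product of the two maxima\<close>

definition max_slope :: "'a set \<Rightarrow> 'a \<Rightarrow> real" where
  "max_slope A x = Max ((\<lambda>a. - D1 x a) ` A)"

lemma max_slope_ge: "finite A \<Longrightarrow> a \<in> A \<Longrightarrow> - D1 x a \<le> max_slope A x"
  by (simp add: max_slope_def)

lemma max_slope_attained:
  assumes "finite A" "A \<noteq> {}"
  obtains a where "a \<in> A" "max_slope A x = - D1 x a"
proof -
  have "max_slope A x \<in> (\<lambda>a. - D1 x a) ` A"
    unfolding max_slope_def using assms by (intro Max_in) auto
  then show thesis using that by blast
qed

lemma max_slope_scaleR:
  assumes "finite A" "A \<noteq> {}" "0 < t" "x \<in> interior C"
  shows "max_slope A (t *\<^sub>R x) = max_slope A x / t"
  using Max_image_mult_left[of A "1 / t" "\<lambda>a. - D1 x a"] assms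
  by (simp add: max_slope_def D1_scaleR)

lemma continuous_on_product:
  assumes "finite A" "A \<noteq> {}" "finite B" "B \<noteq> {}"
  shows "continuous_on (interior C) (\<lambda>x. max_slope A x * max_pairing B x)"
  unfolding max_slope_def max_pairing_def using assms
  by (intro continuous_on_mult continuous_on_Max_image continuous_on_minus continuous_on_D1 continuous_intros)

lemma product_scaleR:
  assumes "finite A" "A \<noteq> {}" "finite B" "B \<noteq> {}" "0 < t" "x \<in> interior C"
  shows "max_slope A (t *\<^sub>R x) * max_pairing B (t *\<^sub>R x) = max_slope A x * max_pairing B x"
  using assms by (simp add: max_slope_scaleR max_pairing_scaleR)

text \<open>At 0 the identity \<open>D1_self\<close> would read
  \<open>0 = - \<theta>\<close>.\<close>

lemma zero_notin_interior: "0 \<notin> interior C"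
  using D1_self[of 0] theta_ge_1 by auto

text \<open>An interior point \<open>u\<close> of the cone spanned by \<open>A\<close> has positive
  slope \<open>- D1 x u\<close>, which is at most a nonnegative multiple of the maximum over
  \<open>A\<close>.\<close>

lemma max_slope_pos:
  assumes "finite A" "cone_span A \<inter> interior C \<noteq> {}" "x \<in> interior C"
  shows "0 < max_slope A x"
proof -
  obtain u where u: "u \<in> cone_span A" "u \<in> interior C" using assms by blast
  from u(1) obtain M where M: "0 \<le> M"
    "\<And>(g :: 'a \<Rightarrow> real) m. linear g \<Longrightarrow> (\<And>a. a \<in> A \<Longrightarrow> g a \<le> m) \<Longrightarrow> g u \<le> M * m"
    by (rule cone_span_linear_bound) blast
  have "0 < - D1 x u" using D1_neg[OF assms(3) u(2)] by simp
  also have "\<dots> \<le> M * max_slope A x"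
    using max_slope_ge[OF assms(1)]
    by (intro M(2) linear_compose_neg bounded_linear.linear blinfun.bounded_linear_right)
  finally show ?thesis using M(1) by (simp add: zero_less_mult_iff)
qed

lemma max_pairing_pos:
  assumes "finite B" "cone_span B \<inter> interior (dual_cone C) \<noteq> {}" "x \<in> interior C"
  shows "0 < max_pairing B x"
proof -
  obtain v where v: "v \<in> cone_span B" "v \<in> interior (dual_cone C)" using assms by blast
  from v(1) obtain M where M: "0 \<le> M"
    "\<And>(g :: 'a \<Rightarrow> real) m. linear g \<Longrightarrow> (\<And>a. a \<in> B \<Longrightarrow> g a \<le> m) \<Longrightarrow> g v \<le> M * m"
    by (rule cone_span_linear_bound) blast
  from v(2) obtain e where e: "0 < e" "\<And>x. x \<in> C \<Longrightarrow> e * norm x \<le> v \<bullet> x"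
    by (rule interior_dual_cone_bound) blast
  have "x \<noteq> 0" using assms(3) zero_notin_interior by auto
  then have "0 < e * norm x" using e(1) by simp
  also have "\<dots> \<le> v \<bullet> x" using e(2) assms(3) interior_subset by blast
  also have "\<dots> \<le> M * max_pairing B x"
    using max_pairing_ge[OF assms(1)]
    by (intro M(2)[of "\<lambda>v. v \<bullet> x"] bounded_linear.linear bounded_linear_inner_left)
  finally show ?thesis using M(1) by (simp add: zero_less_mult_iff)
qed

lemma nonempty_of_cone_span:
  assumes "cone_span A \<inter> interior C \<noteq> {}"
  shows "A \<noteq> {}"
  using assms zero_notin_interior by (auto simp: cone_span_def)

text \<open>The empty set spans only 0, and 0 interior to the dual cone would force every element of
  \<open>C\<close> to vanish.\<close>

lemma nonempty_of_cone_span_dual: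
  assumes "cone_span B \<inter> interior (dual_cone C) \<noteq> {}"
  shows "B \<noteq> {}"
proof
  assume "B = {}"
  then have "0 \<in> interior (dual_cone C)" using assms by (auto simp: cone_span_def)
  then obtain e where e: "0 < e" "\<And>x. x \<in> C \<Longrightarrow> e * norm x \<le> 0 \<bullet> x"
    by (rule interior_dual_cone_bound) blast
  obtain x where x: "x \<in> interior C" using interior_nonempty by blast
  then have "e * norm x \<le> 0" using e(2)[of x] interior_subset by auto
  then show False using e(1) x zero_notin_interior by (auto simp: mult_le_0_iff)
qed

text \<open>On the unit sphere the pairing maximum is bounded away from 0, so a bound on the product
  bounds the slope maximum and hence \<open>- D1 x u\<close>. The tangent at \<open>x\<close>,
  evaluated at the fixed point \<open>u\<close>, then bounds \<open>F x\<close>.\<close>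

lemma F_bounded_on_product_sublevel:
  assumes "finite A" "finite B"
    and "cone_span A \<inter> interior C \<noteq> {}" "cone_span B \<inter> interior (dual_cone C) \<noteq> {}"
  obtains K where "\<And>x. x \<in> interior C \<Longrightarrow> norm x = 1 \<Longrightarrow>
    max_slope A x * max_pairing B x \<le> \<tau> \<Longrightarrow> F x \<le> K"
proof -
  obtain u where u: "u \<in> cone_span A" "u \<in> interior C" using assms by blast
  obtain v where v: "v \<in> cone_span B" "v \<in> interior (dual_cone C)" using assms by blast
  from u(1) obtain M where M: "0 \<le> M"
    "\<And>(g :: 'a \<Rightarrow> real) m. linear g \<Longrightarrow> (\<And>a. a \<in> A \<Longrightarrow> g a \<le> m) \<Longrightarrow> g u \<le> M * m"
    by (rule cone_span_linear_bound) blast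
  from v(1) obtain N where N: "0 \<le> N"
    "\<And>(g :: 'a \<Rightarrow> real) m. linear g \<Longrightarrow> (\<And>a. a \<in> B \<Longrightarrow> g a \<le> m) \<Longrightarrow> g v \<le> N * m"
    by (rule cone_span_linear_bound) blast
  from v(2) obtain e where e: "0 < e" "\<And>x. x \<in> C \<Longrightarrow> e * norm x \<le> v \<bullet> x"
    by (rule interior_dual_cone_bound) blast
  show thesis
  proof
    fix x assume x: "x \<in> interior C" "norm x = 1" "max_slope A x * max_pairing B x \<le> \<tau>"
    have 1: "- D1 x u \<le> M * max_slope A x"
      using max_slope_ge[OF assms(1)]
      by (intro M(2) linear_compose_neg bounded_linear.linear blinfun.bounded_linear_right)
    have "e \<le> v \<bullet> x" using e(2)[of x] x(1,2) interior_subset by auto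
    also have "\<dots> \<le> N * max_pairing B x"
      using max_pairing_ge[OF assms(2)]
      by (intro N(2)[of "\<lambda>v. v \<bullet> x"] bounded_linear.linear bounded_linear_inner_left)
    finally have 2: "e \<le> N * max_pairing B x" .
    have "(- D1 x u) * e \<le> (M * max_slope A x) * (N * max_pairing B x)"
      using 1 2 e(1) D1_neg[OF x(1) u(2)] max_slope_pos[OF assms(1,3) x(1)] M(1)
      by (intro mult_mono) auto
    also have "\<dots> = M * N * (max_slope A x * max_pairing B x)" by simp
    also have "\<dots> \<le> M * N * \<tau>"
      using x(3) M(1) N(1) by (intro mult_left_mono) auto
    finally have "- D1 x u \<le> M * N * \<tau> / e"
      using e(1) by (simp add: field_simps)
    moreover have "F x + D1 x (u - x) \<le> F u"
      using F_above_tangent[OF x(1) u(2)] .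
    ultimately show "F x \<le> F u - \<theta> + M * N * \<tau> / e"
      using D1_self[OF x(1)] by (simp add: blinfun.diff_right)
  qed
qed

text \<open>The point is that limits stay in the interior: a limit on the frontier would make
  \<open>F\<close> blow up along the sequence, against the bound on \<open>F\<close>.\<close>

lemma compact_product_sublevel:
  assumes "finite A" "finite B"
    and "cone_span A \<inter> interior C \<noteq> {}" "cone_span B \<inter> interior (dual_cone C) \<noteq> {}"
  shows "compact {x \<in> interior C. norm x = 1 \<and> max_slope A x * max_pairing B x \<le> \<tau>}"
    (is "compact ?S")
proof -
  obtain K where K: "\<And>x. x \<in> interior C \<Longrightarrow> norm x = 1 \<Longrightarrow>
    max_slope A x * max_pairing B x \<le> \<tau> \<Longrightarrow> F x \<le> K"
    using F_bounded_on_product_sublevel[OF assms, of \<tau>] by metis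
  have cont: "continuous_on (interior C) (\<lambda>x. max_slope A x * max_pairing B x)"
    by (intro continuous_on_product assms(1,2) nonempty_of_cone_span[OF assms(3)]
        nonempty_of_cone_span_dual[OF assms(4)])
  have "closed ?S"
    unfolding closed_sequential_limits
  proof (intro allI impI, elim conjE)
    fix X z assume X: "\<forall>k. X k \<in> ?S" and lim: "X \<longlonglongrightarrow> z"
    have "z \<in> closure C"
      using X lim interior_subset closure_sequential by blast
    have z: "z \<in> interior C"
    proof (rule ccontr)
      assume "z \<notin> interior C"
      then have "z \<in> frontier C" using \<open>z \<in> closure C\<close> by (simp add: frontier_def)
      then have "filterlim (\<lambda>k. F (X k)) at_top sequentially"
        using X lim by (intro blowup[of X z]) auto
      then have "\<forall>\<^sub>F k in sequentially. K + 1 \<le> F (X k)"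
        by (simp only: filterlim_at_top)
      then obtain k where "K + 1 \<le> F (X k)"
        using eventually_happens'[OF sequentially_bot] by blast
      moreover have "F (X k) \<le> K" using X K by blast
      ultimately show False by simp
    qed
    have "(\<lambda>k. norm (X k)) \<longlonglongrightarrow> norm z" using lim by (rule tendsto_norm)
    moreover have "(\<lambda>k. norm (X k)) = (\<lambda>k. 1)" using X by auto
    ultimately have "norm z = 1" by (simp add: LIMSEQ_const_iff)
    moreover have "(\<lambda>k. max_slope A (X k) * max_pairing B (X k)) \<longlonglongrightarrow> max_slope A z * max_pairing B z"
      using X by (intro continuous_on_tendsto_compose[OF cont lim z]) auto
    then have "max_slope A z * max_pairing B z \<le> \<tau>"
      by (rule LIMSEQ_le_const2) (use X in auto)
    ultimately show "z \<in> ?S" using z by simp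
  qed
  moreover have "bounded ?S" by (auto simp: bounded_iff)
  ultimately show ?thesis by (simp add: compact_eq_bounded_closed)
qed

text \<open>Scale invariance of the product is used twice: to restrict the minimisation to the unit
  sphere, where sublevel sets are compact, and to rescale the minimiser until the two maxima
  agree.\<close>

lemma balanced_minimiser_exists:
  assumes "finite A" "finite B"
    and "cone_span A \<inter> interior C \<noteq> {}" "cone_span B \<inter> interior (dual_cone C) \<noteq> {}"
  obtains x where "x \<in> interior C" "max_slope A x = max_pairing B x"
    "\<And>y. y \<in> interior C \<Longrightarrow> max_slope A x * max_pairing B x \<le> max_slope A y * max_pairing B y"
proof -
  define \<Psi> where "\<Psi> x = max_slope A x * max_pairing B x" for x
  note ne = nonempty_of_cone_span[OF assms(3)] nonempty_of_cone_span_dual[OF assms(4)]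
  note scale = product_scaleR[OF assms(1) ne(1) assms(2) ne(2), folded \<Psi>_def]
  have normalize: "(1 / norm y) *\<^sub>R y \<in> interior C" "norm ((1 / norm y) *\<^sub>R y) = 1"
    "\<Psi> ((1 / norm y) *\<^sub>R y) = \<Psi> y" if "y \<in> interior C" for y
  proof -
    have "0 < 1 / norm y" using that zero_notin_interior by auto
    then show "(1 / norm y) *\<^sub>R y \<in> interior C" "norm ((1 / norm y) *\<^sub>R y) = 1"
      "\<Psi> ((1 / norm y) *\<^sub>R y) = \<Psi> y"
      using that interior_scaleR scale by auto
  qed
  obtain x0 where x0: "x0 \<in> interior C" using interior_nonempty by blast
  let ?S = "{x \<in> interior C. norm x = 1 \<and> \<Psi> x \<le> \<Psi> x0}"
  have "compact ?S"
    unfolding \<Psi>_def by (rule compact_product_sublevel[OF assms])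
  moreover have "(1 / norm x0) *\<^sub>R x0 \<in> ?S" using normalize[OF x0] by simp
  then have "?S \<noteq> {}" by blast
  moreover have "continuous_on ?S \<Psi>"
    unfolding \<Psi>_def
    by (rule continuous_on_subset[OF continuous_on_product[OF assms(1) ne(1) assms(2) ne(2)]]) auto
  ultimately have "\<exists>x\<in>?S. \<forall>y\<in>?S. \<Psi> x \<le> \<Psi> y"
    by (rule continuous_attains_inf)
  then obtain x where x: "x \<in> ?S" "\<forall>y\<in>?S. \<Psi> x \<le> \<Psi> y" ..
  \<comment> \<open>A point outside the sublevel set of \<open>x0\<close> has a larger value than
    \<open>x0\<close>, hence than \<open>x\<close>; any other point is normalised into
    \<open>?S\<close>.\<close>
  have min: "\<Psi> x \<le> \<Psi> y" if y: "y \<in> interior C" for y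
  proof (cases "\<Psi> y \<le> \<Psi> x0")
    case True
    then have "(1 / norm y) *\<^sub>R y \<in> ?S" using normalize[OF y] by simp
    from bspec[OF x(2) this] show ?thesis using normalize[OF y] by simp
  qed (use x(1) in simp)
  have xC: "x \<in> interior C" using x(1) by simp
  define \<alpha> \<beta> where "\<alpha> = max_slope A x" and "\<beta> = max_pairing B x"
  have pos: "0 < \<alpha>" "0 < \<beta>"
    using max_slope_pos[OF assms(1,3) xC] max_pairing_pos[OF assms(2,4) xC]
    by (auto simp: \<alpha>_def \<beta>_def)
  \<comment> \<open>Scaling by \<open>t\<close> turns the maxima into \<open>\<alpha> / t\<close>
    and \<open>t * \<beta>\<close>; this \<open>t\<close> makes them equal.\<close>
  define t where "t = sqrt (\<alpha> / \<beta>)"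
  have t: "0 < t" using pos by (simp add: t_def)
  have "t * t = \<alpha> / \<beta>" using pos by (simp add: t_def)
  then have "\<alpha> / t = t * \<beta>" using t pos by (simp add: field_simps)
  show thesis
  proof
    show "t *\<^sub>R x \<in> interior C" using xC t by (rule interior_scaleR)
    show "max_slope A (t *\<^sub>R x) = max_pairing B (t *\<^sub>R x)"
      using max_slope_scaleR[OF assms(1) ne(1) t xC] max_pairing_scaleR[OF assms(2) ne(2) t]
        \<open>\<alpha> / t = t * \<beta>\<close> by (simp add: \<alpha>_def \<beta>_def)
    show "max_slope A (t *\<^sub>R x) * max_pairing B (t *\<^sub>R x) \<le> max_slope A y * max_pairing B y"
      if "y \<in> interior C" for y
      using min[OF that] scale[OF t xC] by (simp add: \<Psi>_def)
  qed
qed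

section \<open>First-order conditions at the minimiser\<close>

lemma product_decreases:
  assumes x: "x \<in> interior C" and a: "a \<in> C" and b: "b \<in> dual_cone C" and "0 < \<sigma>"
    and le: "- D1 x a \<le> \<sigma>" "b \<bullet> x \<le> \<sigma>"
    and active: "- D1 x a = \<sigma> \<Longrightarrow> b \<bullet> x = \<sigma> \<Longrightarrow> b \<bullet> k < D2 x k a"
  shows "\<forall>\<^sub>F t in at_right 0. - D1 (x + t *\<^sub>R k) a * (b \<bullet> (x + t *\<^sub>R k)) < \<sigma> * \<sigma>"
proof -
  define \<psi> where "\<psi> t = - D1 (x + t *\<^sub>R k) a * (b \<bullet> (x + t *\<^sub>R k))" for t
  have D: "(\<psi> has_real_derivative (- D2 x k a * (b \<bullet> x) + (b \<bullet> k) * (- D1 x a))) (at 0)"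
  proof -
    have "((\<lambda>t. D1 (x + t *\<^sub>R k) a) has_real_derivative D2 x k a) (at 0)"
      using F_along_line(2)[of x 0 k a] x by simp
    moreover have "((\<lambda>t. b \<bullet> (x + t *\<^sub>R k)) has_real_derivative b \<bullet> k) (at 0)"
      unfolding inner_add_right inner_scaleR_right by (auto intro!: derivative_eq_intros)
    ultimately have "(\<psi> has_real_derivative
        - D2 x k a * (b \<bullet> (x + 0 *\<^sub>R k)) + (b \<bullet> k) * (- D1 (x + 0 *\<^sub>R k) a)) (at 0)"
      unfolding \<psi>_def by (intro DERIV_mult DERIV_minus)
    then show ?thesis by simp
  qed
  have "\<forall>\<^sub>F t in at_right 0. \<psi> t < \<sigma> * \<sigma>"
  \<comment> \<open>If both factors equal \<open>\<sigma>\<close>, the product starts at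
    \<open>\<sigma> * \<sigma>\<close> with negative derivative. Otherwise one factor is smaller,
    the product starts strictly below, and continuity keeps it there.\<close>
  proof (cases "- D1 x a = \<sigma> \<and> b \<bullet> x = \<sigma>")
    case True
    then have "- D2 x k a * (b \<bullet> x) + (b \<bullet> k) * (- D1 x a) = \<sigma> * (b \<bullet> k - D2 x k a)"
      by (simp add: algebra_simps)
    also have "\<dots> < 0"
      using active True \<open>0 < \<sigma>\<close> by (simp add: mult_pos_neg)
    finally obtain d where d: "0 < d" "\<forall>h>0. h < d \<longrightarrow> \<psi> (0 + h) < \<psi> 0"
      using DERIV_neg_dec_right[OF D] by blast
    have "\<psi> 0 = \<sigma> * \<sigma>" using True by (simp add: \<psi>_def)
    then show ?thesis
      using d by (auto simp: eventually_at_right_field intro!: exI[of _ d])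
  next
    case False
    have nonneg: "0 \<le> - D1 x a" "0 \<le> b \<bullet> x"
      using D1_nonpos[OF x a] b x interior_subset by (auto simp: dual_cone_def)
    have "- D1 x a * (b \<bullet> x) < \<sigma> * \<sigma>"
    proof (cases "- D1 x a = \<sigma>")
      case True
      then have "b \<bullet> x < \<sigma>" using False le by auto
      then show ?thesis using True \<open>0 < \<sigma>\<close> by (metis mult_strict_left_mono)
    next
      case False
      then have "- D1 x a < \<sigma>" using le by auto
      then have "- D1 x a * \<sigma> < \<sigma> * \<sigma>"
        using \<open>0 < \<sigma>\<close> by (rule mult_strict_right_mono)
      moreover have "- D1 x a * (b \<bullet> x) \<le> - D1 x a * \<sigma>"
        using le(2) nonneg(1) by (rule mult_left_mono)
      ultimately show ?thesis by linarith
    qed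
    then have "\<psi> 0 < \<sigma> * \<sigma>" by (simp add: \<psi>_def)
    moreover have "(\<psi> \<longlongrightarrow> \<psi> 0) (at_right 0)"
      using DERIV_isCont[OF D] by (simp add: isCont_def filterlim_at_split)
    ultimately show ?thesis by (rule order_tendstoD(2)[rotated])
  qed
  then show ?thesis by (simp add: \<psi>_def)
qed

text \<open>
  If no such \<open>u\<close> existed, a hyperplane with normal \<open>h\<close> would separate the Hessian image of the active
  part of \<open>A\<close> from the active part of \<open>B\<close>, and moving along \<open>- h\<close> would decrease every active product.
\<close>

lemma stationarity:
  assumes "finite A" "A \<noteq> {}" "A \<subseteq> C" "finite B" "B \<noteq> {}" "B \<subseteq> dual_cone C"
    and x: "x \<in> interior C" and \<sigma>: "max_slope A x = \<sigma>" "max_pairing B x = \<sigma>" "0 < \<sigma>"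
    and min: "\<And>y. y \<in> interior C \<Longrightarrow> \<sigma> * \<sigma> \<le> max_slope A y * max_pairing B y"
  obtains u where "u \<in> convex hull {a \<in> A. - D1 x a = \<sigma>}"
    "hessian F x u \<in> convex hull {b \<in> B. b \<bullet> x = \<sigma>}"
proof -
  let ?A = "{a \<in> A. - D1 x a = \<sigma>}" and ?B = "{b \<in> B. b \<bullet> x = \<sigma>}"
  obtain L where L: "L \<in> cone_aut C" "hessian F x = adjoint L \<circ> L"
    using hessian_factor[OF x] by blast
  note lin = cone_aut_linear[OF L(1)]
  have lin_H: "linear (hessian F x)"
    unfolding L(2) by (intro linear_compose lin adjoint_linear)
  let ?P = "hessian F x ` (convex hull ?A)" and ?Q = "convex hull ?B"
  have "?P \<inter> ?Q \<noteq> {}"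
  proof
    assume "?P \<inter> ?Q = {}"
    moreover have "?Q \<noteq> {}"
      using max_pairing_attained[OF assms(4,5), of x] \<sigma>(2) by (metis (mono_tags, lifting) convex_hull_eq_empty empty_iff mem_Collect_eq)
    moreover have "compact ?P"
      using assms(1) lin_H
      by (intro compact_continuous_image linear_continuous_on finite_imp_compact_convex_hull)
        (auto simp: linear_conv_bounded_linear)
    moreover have "compact ?Q"
      using assms(4) by (intro finite_imp_compact_convex_hull) auto
    moreover have "convex ?P"
      using lin_H by (intro convex_linear_image convex_convex_hull)
    ultimately have "\<exists>h c. (\<forall>p\<in>?P. h \<bullet> p < c) \<and> (\<forall>q\<in>?Q. c < h \<bullet> q)"
      by (intro separating_hyperplane_closed_compact) (auto intro: compact_imp_closed)
    then obtain h c where hc: "\<forall>p\<in>?P. h \<bullet> p < c" "\<forall>q\<in>?Q. c < h \<bullet> q"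
      by blast
    have active: "b \<bullet> (- h) < D2 x (- h) a" if "a \<in> ?A" "b \<in> ?B" for a b
    proof -
      have "D2 x h a = h \<bullet> hessian F x a"
        using hessian_form[OF x L(2) lin, of h a] adjoint_works[OF lin, of h "L a"] L(2) by simp
      also have "\<dots> < c" using hc(1) that(1) by (meson hull_inc imageI)
      also have "\<dots> < h \<bullet> b" using hc(2) that(2) by (meson hull_inc)
      finally show ?thesis by (simp add: inner_commute blinfun.minus_right blinfun.minus_left)
    qed
    \<comment> \<open>Finiteness of \<open>A\<close> and \<open>B\<close> lets one small
      \<open>t\<close> serve all pairs.\<close>
    have "\<forall>\<^sub>F t in at_right 0. \<forall>a\<in>A. \<forall>b\<in>B.
        - D1 (x + t *\<^sub>R (- h)) a * (b \<bullet> (x + t *\<^sub>R (- h))) < \<sigma> * \<sigma>"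
      using assms(1,3,4,6) active max_slope_ge[OF assms(1), of _ x] max_pairing_ge[OF assms(4), of _ x] \<sigma>
      by (intro eventually_ball_finite ballI product_decreases x) auto
    moreover have "\<forall>\<^sub>F t in at_right 0. x + t *\<^sub>R (- h) \<in> interior C"
    proof (rule topological_tendstoD)
      have "((\<lambda>t. x + t *\<^sub>R (- h)) \<longlongrightarrow> x + 0 *\<^sub>R (- h)) (at_right 0)"
        by (intro tendsto_intros)
      then show "((\<lambda>t. x + t *\<^sub>R (- h)) \<longlongrightarrow> x) (at_right 0)" by simp
    qed (use x in auto)
    ultimately have "\<forall>\<^sub>F t in at_right (0::real). \<exists>y\<in>interior C. \<forall>a\<in>A. \<forall>b\<in>B. - D1 y a * (b \<bullet> y) < \<sigma> * \<sigma>"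
      by eventually_elim blast
    then obtain y where y: "y \<in> interior C" "\<forall>a\<in>A. \<forall>b\<in>B. - D1 y a * (b \<bullet> y) < \<sigma> * \<sigma>"
      using eventually_happens'[OF trivial_limit_at_right_real] by blast
    \<comment> \<open>Both maxima at \<open>y\<close> are attained, so their product is one of the
      pair products, all below \<open>\<sigma> * \<sigma>\<close>; this contradicts
      minimality.\<close>
    obtain a where a: "a \<in> A" "max_slope A y = - D1 y a"
      using assms(1,2) by (rule max_slope_attained)
    obtain b where b: "b \<in> B" "max_pairing B y = b \<bullet> y"
      using assms(4,5) by (rule max_pairing_attained)
    show False using min[OF y(1)] y(2) a b by fastforce
  qed
  then show thesis using that by blast
qed

section \<open>The bound on the common value of the maxima, and the resulting automorphism\<close>

theorem bounded_scaling_exists: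
  assumes "finite A" "A \<subseteq> C" "finite B" "B \<subseteq> dual_cone C"
    and \<Delta>: "\<And>a b. a \<in> A \<Longrightarrow> b \<in> B \<Longrightarrow> a \<bullet> b \<le> \<Delta>"
    and span: "cone_span A \<inter> interior C \<noteq> {}" "cone_span B \<inter> interior (dual_cone C) \<noteq> {}"
  shows "\<exists>L\<in>cone_aut C. (\<forall>a\<in>A. L a \<bullet> L a \<le> \<theta> * \<Delta>) \<and>
    (\<forall>b\<in>B. inv (adjoint L) b \<bullet> inv (adjoint L) b \<le> \<theta> * \<Delta>)"
proof -
  obtain x where x: "x \<in> interior C" "max_slope A x = max_pairing B x"
    and min: "\<And>y. y \<in> interior C \<Longrightarrow> max_slope A x * max_pairing B x \<le> max_slope A y * max_pairing B y"
    using balanced_minimiser_exists[OF assms(1,3) span] by metis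
  define \<sigma> where "\<sigma> = max_slope A x"
  have \<sigma>: "max_slope A x = \<sigma>" "max_pairing B x = \<sigma>" "0 < \<sigma>"
    using x max_slope_pos[OF assms(1) span(1) x(1)] by (auto simp: \<sigma>_def)
  let ?A = "{a \<in> A. - D1 x a = \<sigma>}" and ?B = "{b \<in> B. b \<bullet> x = \<sigma>}"
  have "\<sigma> * \<sigma> \<le> max_slope A y * max_pairing B y" if "y \<in> interior C" for y
    using min[OF that] unfolding \<sigma> .
  with nonempty_of_cone_span_dual[OF span(2)] assms(4) x(1) \<sigma>
  obtain u where u: "u \<in> convex hull ?A" "hessian F x u \<in> convex hull ?B"
    by (rule stationarity[OF assms(1) nonempty_of_cone_span[OF span(1)] assms(2,3)])
  obtain L where L: "L \<in> cone_aut C" "hessian F x = adjoint L \<circ> L"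
    using hessian_factor[OF x(1)] by blast
  note lin = cone_aut_linear[OF L(1)]
  \<comment> \<open>A level set of a linear functional is convex, so \<open>u\<close> inherits the
    slope \<open>\<sigma>\<close> shared by the active elements of \<open>A\<close>.\<close>
  have "convex {u. - D1 x u = \<sigma>}"
  proof (rule convexI)
    fix u v and s t :: real
    assume *: "u \<in> {u. - D1 x u = \<sigma>}" "v \<in> {u. - D1 x u = \<sigma>}" "s + t = 1"
    then have "D1 x u = - \<sigma>" "D1 x v = - \<sigma>" by auto
    then have "D1 x (s *\<^sub>R u + t *\<^sub>R v) = s * (- \<sigma>) + t * (- \<sigma>)"
      by (simp add: blinfun.add_right blinfun.scaleR_right)
    also have "\<dots> = (s + t) * (- \<sigma>)" by (rule distrib_right[symmetric])
    finally show "s *\<^sub>R u + t *\<^sub>R v \<in> {u. - D1 x u = \<sigma>}"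
      using *(3) by simp
  qed
  then have "convex hull ?A \<subseteq> {u. - D1 x u = \<sigma>}"
    by (intro hull_minimal) auto
  then have "D1 x u = - \<sigma>" using u(1) by auto
  then have "\<sigma>\<^sup>2 \<le> \<theta> * D2 x u u"
    using D1_squared_le[OF x(1), of u] by simp
  also have "D2 x u u = u \<bullet> hessian F x u"
    using hessian_form[OF x(1) L(2) lin, of u u] adjoint_works[OF lin, of u "L u"] L(2) by simp
  also have "\<theta> * (u \<bullet> hessian F x u) \<le> \<theta> * \<Delta>"
    using theta_ge_1 by (intro mult_left_mono inner_le_on_convex_hulls[OF _ u]) (auto intro: \<Delta>)
  finally have bound: "\<sigma>\<^sup>2 \<le> \<theta> * \<Delta>" .
  show ?thesis
  proof (intro bexI[OF _ L(1)] conjI ballI)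
    fix a assume a: "a \<in> A"
    have "L a \<bullet> L a = D2 x a a" using hessian_form[OF x(1) L(2) lin] by simp
    also have "\<dots> \<le> (- D1 x a)\<^sup>2" using ray_bound[OF x(1)] a assms(2) by auto
    also have "\<dots> \<le> \<sigma>\<^sup>2"
      using max_slope_ge[OF assms(1) a, of x] \<sigma>(1) D1_nonpos[OF x(1)] a assms(2)
      by (intro power_mono) auto
    finally show "L a \<bullet> L a \<le> \<theta> * \<Delta>" using bound by simp
  next
    fix b assume b: "b \<in> B"
    have "inv (adjoint L) b \<bullet> inv (adjoint L) b \<le> (b \<bullet> x)\<^sup>2"
      using dual_bound[OF x(1) _ L] b assms(4) by blast
    also have "\<dots> \<le> \<sigma>\<^sup>2"
      using max_pairing_ge[OF assms(3) b, of x] \<sigma>(2) b assms(4) x(1) interior_subset[of C]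
      by (intro power_mono) (auto simp: dual_cone_def)
    finally show "inv (adjoint L) b \<bullet> inv (adjoint L) b \<le> \<theta> * \<Delta>" using bound by simp
  qed
qed

end

theorem theorem8:
  fixes C :: "(real ^ 'n) set" and F :: "real ^ 'n \<Rightarrow> real" and \<theta> \<Delta> :: real
    and A B :: "(real ^ 'n) set"
  assumes "homogeneous_cone C"
    and "lhscb \<theta> C F"
    and a: "\<theta> \<le> real CARD('n)"
    and b: "\<exists>g :: (real ^ 'n \<Rightarrow> real ^ 'n) \<Rightarrow> real.
              \<forall>L\<in>cone_aut C. \<forall>x\<in>interior C. F (L x) = F x + g L"
    and c: "\<forall>u\<in>C. convex_on (interior C) (\<lambda>x. (- grad F x) \<bullet> u)"
    and d: "\<forall>x\<in>interior C. \<exists>L\<in>cone_aut C. hessian F x = adjoint L \<circ> L"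
    and "finite A" and "A \<subseteq> C"
    and "finite B" and "B \<subseteq> dual_cone C"
    and "\<forall>a\<in>A. \<forall>b\<in>B. a \<bullet> b \<le> \<Delta>"
    and "cone_span A \<inter> interior C \<noteq> {}"
    and "cone_span B \<inter> interior (dual_cone C) \<noteq> {}"
  shows "\<exists>L\<in>cone_aut C.
           (\<forall>a\<in>A. L a \<bullet> L a \<le> \<theta> * \<Delta>) \<and>
           (\<forall>b\<in>B. inv (adjoint L) b \<bullet> inv (adjoint L) b \<le> \<theta> * \<Delta>)"
proof -
  interpret barrier_of_cone C F \<theta>
    using assms(1,2) d by unfold_locales (auto simp: homogeneous_cone_def)
  show ?thesis
    using assms by (intro bounded_scaling_exists) auto
qed

end
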